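(* The assignment sending an admissible $*$-tring $E$ to the basic triple $(E,E_0^r,\langle\cdot,\cdot\rangle_r)$, and a homomorphism of $*$-trings $\pi:E\to F$ between admissible $*$-trings to the pair $(\pi,\pi_0^r):(E,E_0^r,\langle\cdot,\cdot\rangle_r)\to(F,F_0^r,\langle\cdot,\cdot\rangle_r)$, defines a functor from the category of admissible $*$-trings into the category of admissible and full (right) basic triples.
   Context: A $*$-ternary ring ($*$-tring) is a complex vector space $E$ with a map $(\cdot,\cdot,\cdot):E\times E\times E\to E$, linear in the first and third variables and conjugate linear in the second, such that $((x,y,z),u,v)=(x,(u,z,y),v)=(x,y,(z,u,v))$ for all $x,y,z,u,v\in E$. A homomorphism of $*$-trings is a linear map preserving the ternary products. A $*$-tring $E$ is admissible if $(x,x,x)=0$ implies $x=0$. A $*$-algebra $A$ is admissible if $a^*a=0$ implies $a=0$. A (right) basic triple is a triple $(E,A,\langle\cdot,\cdot\rangle)$ where $E$ is a complex vector space, $A$ is a $*$-algebra over which $E$ is a right module, and $\langle\cdot,\cdot\rangle:E\times E\to A$ is sesquilinear (conjugate linear in the first variable) with $\langle x,y\rangle a=\langle x,ya\rangle$ and $\langle x,y\rangle^*=\langle y,x\rangle$. Its associated $*$-tring is $E$ with $(x,y,z)=x\langle y,z\rangle$. It is admissible if $A$ is admissible, and full if $\mathrm{span}\{\langle x,y\rangle: x,y\in E\}=A$. A homomorphism of basic triples $(E,A,\langle\cdot,\cdot\rangle_A)\to(F,B,\langle\cdot,\cdot\rangle_B)$ is a pair $(\varphi,\psi)$ with $\varphi:E\to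 F$ linear, $\psi:A\to B$ a homomorphism of $*$-algebras, and $\varphi(xa)=\varphi(x)\psi(a)$. For an admissible $*$-tring $E$, $(E,E_0^r,\langle\cdot,\cdot\rangle_r)$ is the (unique up to canonical isomorphism) full admissible basic triple with associated $*$-tring $E$. Concretely, with $\theta_{y,z}:E\to E$, $\theta_{y,z}(x)=(x,y,z)$: $E_0^r=\mathrm{span}\{\theta_{y,z}:y,z\in E\}$, with product opposite to composition, involution determined by $\theta_{y,z}^*=\theta_{z,y}$, right action $xT=T(x)$, and $\langle y,z\rangle_r=\theta_{y,z}$. For a homomorphism $\pi:E\to F$, $\pi_0^r:E_0^r\to F_0^r$ is the unique $*$-homomorphism with $\pi_0^r(\langle x,y\rangle_r)=\langle\pi(x),\pi(y)\rangle_r$ for all $x,y\in E$. *)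

theory Defs
  imports "HOL-Algebra.Algebraic_Closure_Type" Complex_Main
begin

text \<open>
  Complex vector spaces are modules, in the sense of HOL-Algebra, over the field of complex
  numbers.  The record type of such modules also has fields for a multiplication and a unit:
  the multiplication is used only for algebras, and the unit is never constrained
  (algebras need not be unital).
\<close>

abbreviation complex_ring :: "complex ring" where
  "complex_ring \<equiv> ring_of_type_algebra"

definition semilinear_maps ::
  "(complex \<Rightarrow> complex) \<Rightarrow> (complex, 'a, 'm) module_scheme \<Rightarrow> (complex, 'b, 'n) module_scheme
    \<Rightarrow> ('a \<Rightarrow> 'b) set" where
  "semilinear_maps s V W = {f \<in> carrier V \<rightarrow> carrier W.
     (\<forall>x\<in>carrier V. \<forall>y\<in>carrier V. f (x \<oplus>\<^bsub>V\<^esub> y) = f x \<oplus>\<^bsub>W\<^esub> f y) \<and>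
     (\<forall>c. \<forall>x\<in>carrier V. f (c \<odot>\<^bsub>V\<^esub> x) = s c \<odot>\<^bsub>W\<^esub> f x)}"

abbreviation "linear_maps \<equiv> semilinear_maps (\<lambda>c. c)"
abbreviation "antilinear_maps \<equiv> semilinear_maps cnj"

definition linspan :: "(complex, 'a, 'm) module_scheme \<Rightarrow> 'a set \<Rightarrow> 'a set" where
  "linspan V S = {finsum V (\<lambda>x. c x \<odot>\<^bsub>V\<^esub> x) T | c T. finite T \<and> T \<subseteq> S}"

section \<open>Ternary rings with involution\<close>

record 'a tring = "(complex, 'a) module" +
  tprod :: "'a \<Rightarrow> 'a \<Rightarrow> 'a \<Rightarrow> 'a"

locale star_tring = module complex_ring E for E :: "('a, 'm) tring_scheme" +
  assumes tprod_linear1: "\<lbrakk>y \<in> carrier E; z \<in> carrier E\<rbrakk>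
      \<Longrightarrow> (\<lambda>x. tprod E x y z) \<in> linear_maps E E"
    and tprod_antilinear2: "\<lbrakk>x \<in> carrier E; z \<in> carrier E\<rbrakk>
      \<Longrightarrow> (\<lambda>y. tprod E x y z) \<in> antilinear_maps E E"
    and tprod_linear3: "\<lbrakk>x \<in> carrier E; y \<in> carrier E\<rbrakk>
      \<Longrightarrow> (\<lambda>z. tprod E x y z) \<in> linear_maps E E"
    and tprod_assoc1:
      "\<lbrakk>x \<in> carrier E; y \<in> carrier E; z \<in> carrier E; u \<in> carrier E; v \<in> carrier E\<rbrakk>
      \<Longrightarrow> tprod E (tprod E x y z) u v = tprod E x (tprod E u z y) v"
    and tprod_assoc2:
      "\<lbrakk>x \<in> carrier E; y \<in> carrier E; z \<in> carrier E; u \<in> carrier E; v \<in> carrier E\<rbrakk>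
      \<Longrightarrow> tprod E x (tprod E u z y) v = tprod E x y (tprod E z u v)"

locale admissible_star_tring = star_tring +
  assumes admissible: "\<lbrakk>x \<in> carrier E; tprod E x x x = \<zero>\<^bsub>E\<^esub>\<rbrakk> \<Longrightarrow> x = \<zero>\<^bsub>E\<^esub>"

text \<open>
  Here and below, morphisms are extensional (\<open>undefined\<close> outside the carrier), so that equality
  of morphisms is equality of maps on the carrier.
\<close>

definition tring_homs :: "'a tring \<Rightarrow> 'b tring \<Rightarrow> ('a \<Rightarrow> 'b) set" where
  "tring_homs E F = {f \<in> linear_maps E F \<inter> extensional (carrier E).
     \<forall>x\<in>carrier E. \<forall>y\<in>carrier E. \<forall>z\<in>carrier E.
       f (tprod E x y z) = tprod F (f x) (f y) (f z)}"

section \<open>Algebras with involution and basic triples\<close>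

record 'a star_alg = "(complex, 'a) module" +
  star :: "'a \<Rightarrow> 'a"

locale star_algebra = module complex_ring A for A :: "('a, 'm) star_alg_scheme" +
  assumes mult_linear1: "y \<in> carrier A \<Longrightarrow> (\<lambda>x. x \<otimes>\<^bsub>A\<^esub> y) \<in> linear_maps A A"
    and mult_linear2: "x \<in> carrier A \<Longrightarrow> (\<lambda>y. x \<otimes>\<^bsub>A\<^esub> y) \<in> linear_maps A A"
    and mult_assoc: "\<lbrakk>x \<in> carrier A; y \<in> carrier A; z \<in> carrier A\<rbrakk>
      \<Longrightarrow> (x \<otimes>\<^bsub>A\<^esub> y) \<otimes>\<^bsub>A\<^esub> z = x \<otimes>\<^bsub>A\<^esub> (y \<otimes>\<^bsub>A\<^esub> z)"
    and star_antilinear: "star A \<in> antilinear_maps A A"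
    and star_star: "x \<in> carrier A \<Longrightarrow> star A (star A x) = x"
    and star_mult: "\<lbrakk>x \<in> carrier A; y \<in> carrier A\<rbrakk>
      \<Longrightarrow> star A (x \<otimes>\<^bsub>A\<^esub> y) = star A y \<otimes>\<^bsub>A\<^esub> star A x"

locale admissible_star_algebra = star_algebra +
  assumes admissible: "\<lbrakk>a \<in> carrier A; star A a \<otimes>\<^bsub>A\<^esub> a = \<zero>\<^bsub>A\<^esub>\<rbrakk> \<Longrightarrow> a = \<zero>\<^bsub>A\<^esub>"

definition star_alg_homs :: "'a star_alg \<Rightarrow> 'b star_alg \<Rightarrow> ('a \<Rightarrow> 'b) set" where
  "star_alg_homs A B = {f \<in> linear_maps A B \<inter> extensional (carrier A).
     (\<forall>x\<in>carrier A. \<forall>y\<in>carrier A. f (x \<otimes>\<^bsub>A\<^esub> y) = f x \<otimes>\<^bsub>B\<^esub> f y) \<and>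
     (\<forall>x\<in>carrier A. f (star A x) = star B (f x))}"

record ('a, 'b) triple =
  space :: "(complex, 'a) module"
  alg :: "'b star_alg"
  act :: "'a \<Rightarrow> 'b \<Rightarrow> 'a"
  ip :: "'a \<Rightarrow> 'a \<Rightarrow> 'b"

locale basic_triple =
  E: module complex_ring "space T" + A: star_algebra "alg T" for T :: "('a, 'b) triple" +
  assumes act_linear1: "a \<in> carrier (alg T)
      \<Longrightarrow> (\<lambda>x. act T x a) \<in> linear_maps (space T) (space T)"
    and act_linear2: "x \<in> carrier (space T)
      \<Longrightarrow> (\<lambda>a. act T x a) \<in> linear_maps (alg T) (space T)"
    and act_assoc: "\<lbrakk>x \<in> carrier (space T); a \<in> carrier (alg T); b \<in> carrier (alg T)\<rbrakk>
      \<Longrightarrow> act T (act T x a) b = act T x (a \<otimes>\<^bsub>alg T\<^esub> b)"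
    and ip_antilinear1: "y \<in> carrier (space T)
      \<Longrightarrow> (\<lambda>x. ip T x y) \<in> antilinear_maps (space T) (alg T)"
    and ip_linear2: "x \<in> carrier (space T)
      \<Longrightarrow> (\<lambda>y. ip T x y) \<in> linear_maps (space T) (alg T)"
    and ip_act: "\<lbrakk>x \<in> carrier (space T); y \<in> carrier (space T); a \<in> carrier (alg T)\<rbrakk>
      \<Longrightarrow> ip T x y \<otimes>\<^bsub>alg T\<^esub> a = ip T x (act T y a)"
    and ip_star: "\<lbrakk>x \<in> carrier (space T); y \<in> carrier (space T)\<rbrakk>
      \<Longrightarrow> star (alg T) (ip T x y) = ip T y x"

locale admissible_full_basic_triple =
  basic_triple T + A: admissible_star_algebra "alg T" for T :: "('a, 'b) triple" +
  assumes full: "linspan (alg T) {ip T x y | x y. x \<in> carrier (space T) \<and> y \<in> carrier (space T)}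
      = carrier (alg T)"

definition triple_homs ::
  "('a, 'b) triple \<Rightarrow> ('c, 'd) triple \<Rightarrow> (('a \<Rightarrow> 'c) \<times> ('b \<Rightarrow> 'd)) set" where
  "triple_homs T U = {(f, g).
     f \<in> linear_maps (space T) (space U) \<inter> extensional (carrier (space T)) \<and>
     g \<in> star_alg_homs (alg T) (alg U) \<and>
     (\<forall>x\<in>carrier (space T). \<forall>a\<in>carrier (alg T). f (act T x a) = act U (f x) (g a))}"

section \<open>Categories and functors\<close>

record ('o, 'm) cat =
  objs :: "'o set"
  homs :: "'o \<Rightarrow> 'o \<Rightarrow> 'm set"
  ident :: "'o \<Rightarrow> 'm"
  comp :: "'o \<Rightarrow> 'o \<Rightarrow> 'o \<Rightarrow> 'm \<Rightarrow> 'm \<Rightarrow> 'm"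

text \<open>\<open>comp C b c d g f\<close> is the composite of \<open>f : b \<rightarrow> c\<close> followed by \<open>g : c \<rightarrow> d\<close>.\<close>

locale category =
  fixes C :: "('o, 'm) cat"
  assumes ident_in: "b \<in> objs C \<Longrightarrow> ident C b \<in> homs C b b"
    and comp_in: "\<lbrakk>b \<in> objs C; c \<in> objs C; d \<in> objs C; f \<in> homs C b c; g \<in> homs C c d\<rbrakk>
      \<Longrightarrow> comp C b c d g f \<in> homs C b d"
    and comp_ident: "\<lbrakk>b \<in> objs C; c \<in> objs C; f \<in> homs C b c\<rbrakk>
      \<Longrightarrow> comp C b b c f (ident C b) = f"
    and ident_comp: "\<lbrakk>b \<in> objs C; c \<in> objs C; f \<in> homs C b c\<rbrakk>
      \<Longrightarrow> comp C b c c (ident C c) f = f"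
    and comp_assoc: "\<lbrakk>a \<in> objs C; b \<in> objs C; c \<in> objs C; d \<in> objs C;
        f \<in> homs C a b; g \<in> homs C b c; h \<in> homs C c d\<rbrakk>
      \<Longrightarrow> comp C a b d (comp C b c d h g) f = comp C a c d h (comp C a b c g f)"

locale category_functor = C: category C + D: category D
  for C :: "('o, 'm) cat" and D :: "('p, 'n) cat" +
  fixes F\<^sub>o :: "'o \<Rightarrow> 'p" and F\<^sub>m :: "'o \<Rightarrow> 'o \<Rightarrow> 'm \<Rightarrow> 'n"
  assumes map_obj: "b \<in> objs C \<Longrightarrow> F\<^sub>o b \<in> objs D"
    and map_hom: "\<lbrakk>b \<in> objs C; c \<in> objs C; f \<in> homs C b c\<rbrakk>
      \<Longrightarrow> F\<^sub>m b c f \<in> homs D (F\<^sub>o b) (F\<^sub>o c)"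
    and map_ident: "b \<in> objs C \<Longrightarrow> F\<^sub>m b b (ident C b) = ident D (F\<^sub>o b)"
    and map_comp: "\<lbrakk>b \<in> objs C; c \<in> objs C; d \<in> objs C; f \<in> homs C b c; g \<in> homs C c d\<rbrakk>
      \<Longrightarrow> F\<^sub>m b d (comp C b c d g f) = comp D (F\<^sub>o b) (F\<^sub>o c) (F\<^sub>o d) (F\<^sub>m c d g) (F\<^sub>m b c f)"

text \<open>
  The objects of these categories are all structures whose carriers are subsets of the given types.
\<close>

definition tring_cat :: "('a tring, 'a \<Rightarrow> 'a) cat" where
  "tring_cat = \<lparr>
     objs = {E. admissible_star_tring E},
     homs = tring_homs,
     ident = (\<lambda>E. \<lambda>x\<in>carrier E. x),
     comp = (\<lambda>E F G g f. compose (carrier E) g f)\<rparr>"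

definition triple_cat :: "(('a, 'b) triple, ('a \<Rightarrow> 'a) \<times> ('b \<Rightarrow> 'b)) cat" where
  "triple_cat = \<lparr>
     objs = {T. admissible_full_basic_triple T},
     homs = triple_homs,
     ident = (\<lambda>T. (\<lambda>x\<in>carrier (space T). x, \<lambda>a\<in>carrier (alg T). a)),
     comp = (\<lambda>T U V g f. (compose (carrier (space T)) (fst g) (fst f),
                         compose (carrier (alg T)) (snd g) (snd f)))\<rparr>"

section \<open>The canonical basic triple of an admissible ternary ring\<close>

definition \<theta> :: "'a tring \<Rightarrow> 'a \<Rightarrow> 'a \<Rightarrow> 'a \<Rightarrow> 'a" where
  "\<theta> E y z = (\<lambda>x\<in>carrier E. tprod E x y z)"

text \<open>The algebra of endomorphisms, with product opposite to composition.\<close>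

definition endos_op :: "'a tring \<Rightarrow> (complex, 'a \<Rightarrow> 'a) module" where
  "endos_op E = \<lparr>
     carrier = linear_maps E E \<inter> extensional (carrier E),
     monoid.mult = (\<lambda>S T. compose (carrier E) T S),
     one = (\<lambda>x\<in>carrier E. x),
     zero = (\<lambda>x\<in>carrier E. \<zero>\<^bsub>E\<^esub>),
     add = (\<lambda>S T. \<lambda>x\<in>carrier E. S x \<oplus>\<^bsub>E\<^esub> T x),
     module.smult = (\<lambda>c T. \<lambda>x\<in>carrier E. c \<odot>\<^bsub>E\<^esub> T x)\<rparr>"

definition E0r_module :: "'a tring \<Rightarrow> (complex, 'a \<Rightarrow> 'a) module" where
  "E0r_module E = (endos_op E)
     \<lparr>carrier := linspan (endos_op E) {\<theta> E y z | y z. y \<in> carrier E \<and> z \<in> carrier E}\<rparr>"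

text \<open>
  For an admissible \<open>E\<close> the involution and, below, the induced homomorphism are uniquely
  determined by their values on the spanning elements \<open>\<theta> E y z\<close>; that they exist is where
  admissibility enters.
\<close>

definition E0r_star :: "'a tring \<Rightarrow> ('a \<Rightarrow> 'a) \<Rightarrow> ('a \<Rightarrow> 'a)" where
  "E0r_star E = (THE j.
     j \<in> antilinear_maps (E0r_module E) (E0r_module E) \<inter> extensional (carrier (E0r_module E)) \<and>
     (\<forall>y\<in>carrier E. \<forall>z\<in>carrier E. j (\<theta> E y z) = \<theta> E z y))"

definition E0r :: "'a tring \<Rightarrow> ('a \<Rightarrow> 'a) star_alg" where
  "E0r E = module.extend (E0r_module E) (star_alg.fields (E0r_star E))"

definition canonical_triple :: "'a tring \<Rightarrow> ('a, 'a \<Rightarrow> 'a) triple" where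
  "canonical_triple E =
     \<lparr>space = module.truncate E, alg = E0r E, act = (\<lambda>x T. T x), ip = \<theta> E\<rparr>"

definition pi0r :: "'a tring \<Rightarrow> 'b tring \<Rightarrow> ('a \<Rightarrow> 'b) \<Rightarrow> ('a \<Rightarrow> 'a) \<Rightarrow> ('b \<Rightarrow> 'b)" where
  "pi0r E F p = (THE q. q \<in> star_alg_homs (E0r E) (E0r F) \<and>
     (\<forall>x\<in>carrier E. \<forall>y\<in>carrier E. q (\<theta> E x y) = \<theta> F (p x) (p y)))"

end

(*
  The identity (S x, u, v) = (x, T u, v) determines T from S in an admissible ring: applied to
  differences it gives (w, w, w) = 0. It holds for S = theta y z and T = theta z y, so adjoints exist
  on the whole span and give the involution. If S* S = 0 then (S* x, S* x, S* x) = (S (S* x), x, S* x)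
  = 0 for all x, hence S* = 0: the algebra is admissible. For a homomorphism p, the image of S is the
  unique T in the span of the theta (p x) (p y) with T (p x) = p (S x): an element D of this span
  vanishing on the range of p satisfies theta (p x) (p y) D = theta (p x) (D (p y)) = 0, so D* D = 0.
  Functoriality follows from uniqueness, since homomorphisms are determined by their values on the
  theta y z.
*)

theory Submission
  imports Defs
begin

section \<open>Complex scalars and transfer of vector space structure\<close>

lemma complex_ring_simps [simp]:
  "carrier complex_ring = UNIV" "add complex_ring a b = a + b" "monoid.mult complex_ring a b = a * b"
  "one complex_ring = 1" "zero complex_ring = 0"
  by (simp_all add: ring_of_type_algebra_def)

text \<open>The module axioms see only the carrier, zero, addition and scalar action. Hence they
  pass between records that differ in their product, unit or further fields: from a submodule of
  \<open>endos_op E\<close> to \<open>E0r E\<close>, and from \<open>E\<close> to its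
  truncation.\<close>

lemma module_transfer:
  assumes "module R M" "carrier N = carrier M" "zero N = zero M" "add N = add M"
    "module.smult N = module.smult M"
  shows "module R N"
proof -
  interpret module R M by fact
  have "abelian_group N"
  proof (rule abelian_groupI)
    show "\<exists>y\<in>carrier N. y \<oplus>\<^bsub>N\<^esub> x = \<zero>\<^bsub>N\<^esub>" if "x \<in> carrier N" for x
      using that assms M.l_neg[of x] M.a_inv_closed[of x] by auto
  qed (use assms in \<open>auto simp: M.add.m_ac\<close>)
  then show ?thesis
    using assms by (intro moduleI is_cring)
      (auto simp: smult_l_distr smult_r_distr smult_assoc1)
qed

section \<open>Semilinear maps and linear spans\<close>

lemma semilinear_mapsI:
  assumes "\<And>x. x \<in> carrier V \<Longrightarrow> f x \<in> carrier W"
    and "\<And>x y. \<lbrakk>x \<in> carrier V; y \<in> carrier V\<rbrakk> \<Longrightarrow> f (x \<oplus>\<^bsub>V\<^esub> y) = f x \<oplus>\<^bsub>W\<^esub> f y"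
    and "\<And>c x. x \<in> carrier V \<Longrightarrow> f (c \<odot>\<^bsub>V\<^esub> x) = s c \<odot>\<^bsub>W\<^esub> f x"
  shows "f \<in> semilinear_maps s V W"
  using assms by (auto simp: semilinear_maps_def)

lemma semilinear_mapsD:
  assumes "f \<in> semilinear_maps s V W"
  shows "x \<in> carrier V \<Longrightarrow> f x \<in> carrier W"
    and "\<lbrakk>x \<in> carrier V; y \<in> carrier V\<rbrakk> \<Longrightarrow> f (x \<oplus>\<^bsub>V\<^esub> y) = f x \<oplus>\<^bsub>W\<^esub> f y"
    and "x \<in> carrier V \<Longrightarrow> f (c \<odot>\<^bsub>V\<^esub> x) = s c \<odot>\<^bsub>W\<^esub> f x"
  using assms by (auto simp: semilinear_maps_def)

lemma semilinear_maps_zero: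
  assumes "f \<in> semilinear_maps s V W" "s 0 = 0" "module complex_ring V" "module complex_ring W"
  shows "f \<zero>\<^bsub>V\<^esub> = \<zero>\<^bsub>W\<^esub>"
proof -
  interpret V: module complex_ring V by fact
  interpret W: module complex_ring W by fact
  have "f (0 \<odot>\<^bsub>V\<^esub> \<zero>\<^bsub>V\<^esub>) = s 0 \<odot>\<^bsub>W\<^esub> f \<zero>\<^bsub>V\<^esub>"
    by (rule semilinear_mapsD(3)[OF assms(1) V.zero_closed])
  then show ?thesis
    using semilinear_mapsD(1)[OF assms(1), of "\<zero>\<^bsub>V\<^esub>"] assms(2) V.smult_l_null W.smult_l_null
    by simp
qed

text \<open>Turns a relation into a map. The involution and the induced homomorphism are both first
  known as a relation \<open>P\<close> that is total, single-valued and compatible with sums and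
  scalars; single-valuedness then forces the chosen function to be semilinear. No structure is
  assumed on \<open>W\<close>, so closure is part of the compatibility hypotheses.\<close>

lemma semilinear_map_exists:
  assumes "module complex_ring V"
    and "\<And>a. a \<in> carrier V \<Longrightarrow> \<exists>b\<in>carrier W. P a b"
    and "\<And>a b b'. \<lbrakk>a \<in> carrier V; b \<in> carrier W; b' \<in> carrier W; P a b; P a b'\<rbrakk> \<Longrightarrow> b = b'"
    and "\<And>a a' b b'. \<lbrakk>a \<in> carrier V; a' \<in> carrier V; b \<in> carrier W; b' \<in> carrier W; P a b; P a' b'\<rbrakk>
      \<Longrightarrow> b \<oplus>\<^bsub>W\<^esub> b' \<in> carrier W \<and> P (a \<oplus>\<^bsub>V\<^esub> a') (b \<oplus>\<^bsub>W\<^esub> b')"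
    and "\<And>c a b. \<lbrakk>a \<in> carrier V; b \<in> carrier W; P a b\<rbrakk>
      \<Longrightarrow> s c \<odot>\<^bsub>W\<^esub> b \<in> carrier W \<and> P (c \<odot>\<^bsub>V\<^esub> a) (s c \<odot>\<^bsub>W\<^esub> b)"
  shows "\<exists>f \<in> semilinear_maps s V W \<inter> extensional (carrier V). \<forall>a\<in>carrier V. P a (f a)"
proof -
  interpret V: module complex_ring V by fact
  obtain g where g: "\<And>a. a \<in> carrier V \<Longrightarrow> g a \<in> carrier W \<and> P a (g a)"
    using assms(2) by metis
  let ?f = "restrict g (carrier V)"
  have "?f \<in> semilinear_maps s V W"
  proof (rule semilinear_mapsI)
    show "?f (x \<oplus>\<^bsub>V\<^esub> y) = ?f x \<oplus>\<^bsub>W\<^esub> ?f y" if "x \<in> carrier V" "y \<in> carrier V" for x y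
      using that g assms(4)[of x y "g x" "g y"]
      by (auto intro!: assms(3)[of "x \<oplus>\<^bsub>V\<^esub> y"])
    show "?f (c \<odot>\<^bsub>V\<^esub> x) = s c \<odot>\<^bsub>W\<^esub> ?f x" if "x \<in> carrier V" for c x
      using that g assms(5)[of x "g x" c] V.smult_closed[of c x]
      by (auto intro!: assms(3)[of "c \<odot>\<^bsub>V\<^esub> x"])
  qed (use g in auto)
  then show ?thesis using g by (intro bexI[of _ ?f]) auto
qed

context
  fixes V :: "(complex, 'a, 'm) module_scheme" and S :: "'a set"
  assumes V: "module complex_ring V" and S: "S \<subseteq> carrier V"
begin

interpretation module complex_ring V by (rule V)

lemma linspan_subset: "linspan V S \<subseteq> carrier V"
  using S by (auto simp: linspan_def intro!: M.finsum_closed)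

lemma linspan_base: "x \<in> S \<Longrightarrow> x \<in> linspan V S"
  using S unfolding linspan_def
  by (intro CollectI exI[of _ "\<lambda>_. 1"] exI[of _ "{x}"]) (auto simp: smult_one[simplified] subset_iff)

lemma linspan_add:
  assumes "x \<in> linspan V S" "y \<in> linspan V S"
  shows "x \<oplus>\<^bsub>V\<^esub> y \<in> linspan V S"
proof -
  obtain c T where x: "x = finsum V (\<lambda>x. c x \<odot>\<^bsub>V\<^esub> x) T" "finite T" "T \<subseteq> S"
    using assms(1) by (auto simp: linspan_def)
  obtain d U where y: "y = finsum V (\<lambda>x. d x \<odot>\<^bsub>V\<^esub> x) U" "finite U" "U \<subseteq> S"
    using assms(2) by (auto simp: linspan_def)
  \<comment> \<open>Extending both coefficient families by zero puts the two combinations over the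
    common index set \<open>T \<union> U\<close>, where they can be added termwise.\<close>
  let ?c = "\<lambda>x. if x \<in> T then c x else 0" and ?d = "\<lambda>x. if x \<in> U then d x else 0"
  have in_V: "z \<in> carrier V" if "z \<in> T \<union> U" for z
    using that x y S by auto
  have "x = finsum V (\<lambda>x. ?c x \<odot>\<^bsub>V\<^esub> x) (T \<union> U)"
    unfolding x(1) by (rule M.add.finprod_mono_neutral_cong_left)
      (use x y in_V smult_l_null in \<open>auto simp: Pi_def\<close>)
  moreover have "y = finsum V (\<lambda>x. ?d x \<odot>\<^bsub>V\<^esub> x) (T \<union> U)"
    unfolding y(1) by (rule M.add.finprod_mono_neutral_cong_left)
      (use x y in_V smult_l_null in \<open>auto simp: Pi_def\<close>)
  ultimately have "x \<oplus>\<^bsub>V\<^esub> y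
      = finsum V (\<lambda>x. ?c x \<odot>\<^bsub>V\<^esub> x \<oplus>\<^bsub>V\<^esub> ?d x \<odot>\<^bsub>V\<^esub> x) (T \<union> U)"
    using in_V by (simp add: M.finsum_addf Pi_def)
  also have "\<dots> = finsum V (\<lambda>x. (?c x + ?d x) \<odot>\<^bsub>V\<^esub> x) (T \<union> U)"
    using in_V smult_l_distr by (intro M.finsum_cong') auto
  finally show ?thesis
    using x y by (auto simp: linspan_def intro!: exI[of _ "\<lambda>x. ?c x + ?d x"] exI[of _ "T \<union> U"])
qed

lemma linspan_smult:
  assumes "x \<in> linspan V S"
  shows "k \<odot>\<^bsub>V\<^esub> x \<in> linspan V S"
proof -
  obtain c T where x: "x = finsum V (\<lambda>x. c x \<odot>\<^bsub>V\<^esub> x) T" "finite T" "T \<subseteq> S"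
    using assms by (auto simp: linspan_def)
  have "k \<odot>\<^bsub>V\<^esub> x = finsum V (\<lambda>x. k \<odot>\<^bsub>V\<^esub> (c x \<odot>\<^bsub>V\<^esub> x)) T"
    unfolding x(1) using x S by (intro finsum_smult_ldistr) auto
  also have "\<dots> = finsum V (\<lambda>x. (k * c x) \<odot>\<^bsub>V\<^esub> x) T"
    using x S smult_assoc1 by (intro M.finsum_cong') auto
  finally show ?thesis
    using x by (auto simp: linspan_def)
qed

lemma linspan_submodule:
  assumes "S \<noteq> {}"
  shows "submodule (linspan V S) complex_ring V"
proof (rule submoduleI)
  obtain a where a: "a \<in> S" using assms by auto
  show "\<zero>\<^bsub>V\<^esub> \<in> linspan V S"
    using linspan_smult[OF linspan_base[OF a], of 0] a S smult_l_null[of a] by auto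
  show "\<ominus>\<^bsub>V\<^esub> x \<in> linspan V S" if "x \<in> linspan V S" for x
  proof -
    have "\<ominus>\<^bsub>V\<^esub> x = (\<ominus>\<^bsub>complex_ring\<^esub> 1) \<odot>\<^bsub>V\<^esub> x"
      using that linspan_subset smult_l_minus[of 1 x] smult_one[of x] by auto
    then show ?thesis using linspan_smult[OF that] by simp
  qed
qed (use linspan_subset linspan_add linspan_smult in auto)

end

text \<open>Induction over a span without a case for zero: as \<open>S\<close> is nonempty, zero is
  reached as the multiple by 0 of a generator. Applications thus treat only generators, sums and
  scalar multiples.\<close>

lemma linspan_induct [consumes 4, case_names base add smult]:
  assumes "module complex_ring V" "S \<subseteq> carrier V" "S \<noteq> {}" "x \<in> linspan V S"
    and base: "\<And>a. a \<in> S \<Longrightarrow> P a"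
    and add: "\<And>a b. \<lbrakk>a \<in> linspan V S; b \<in> linspan V S; P a; P b\<rbrakk> \<Longrightarrow> P (a \<oplus>\<^bsub>V\<^esub> b)"
    and smult: "\<And>c a. \<lbrakk>a \<in> linspan V S; P a\<rbrakk> \<Longrightarrow> P (c \<odot>\<^bsub>V\<^esub> a)"
  shows "P x"
proof -
  interpret module complex_ring V by fact
  note S = assms(2)
  note base_span = linspan_base[OF assms(1,2)]
  obtain a where a: "a \<in> S" using assms(3) by auto
  obtain c T where x: "x = finsum V (\<lambda>x. c x \<odot>\<^bsub>V\<^esub> x) T" "finite T" "T \<subseteq> S"
    using assms(4) by (auto simp: linspan_def)
  have "P (finsum V (\<lambda>x. c x \<odot>\<^bsub>V\<^esub> x) T)" using x(2,3)
  proof (induction T)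
    case empty
    \<comment> \<open>The empty sum is zero, that is, 0 times the generator
      \<open>a\<close>.\<close>
    then show ?case
      using smult[OF base_span base, OF a a, of 0] a S smult_l_null[of a] by auto
  next
    case (insert y T)
    have "finsum V (\<lambda>x. c x \<odot>\<^bsub>V\<^esub> x) T \<in> linspan V S"
      using insert by (auto simp: linspan_def)
    moreover have "P (finsum V (\<lambda>x. c x \<odot>\<^bsub>V\<^esub> x) T)"
      using insert by auto
    moreover have "c y \<odot>\<^bsub>V\<^esub> y \<in> linspan V S" "P (c y \<odot>\<^bsub>V\<^esub> y)"
      using insert smult[OF base_span base] linspan_smult[OF assms(1,2) base_span] by auto
    ultimately have "P (c y \<odot>\<^bsub>V\<^esub> y \<oplus>\<^bsub>V\<^esub> finsum V (\<lambda>x. c x \<odot>\<^bsub>V\<^esub> x) T)"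
      by (intro add)
    then show ?case
      using insert S by (simp add: subset_iff Pi_def)
  qed
  then show ?thesis using x by simp
qed

lemma semilinear_maps_eqI:
  assumes "f \<in> semilinear_maps s V W \<inter> extensional (carrier V)"
    and "g \<in> semilinear_maps s V W \<inter> extensional (carrier V)"
    and "module complex_ring V" "S \<subseteq> carrier V" "S \<noteq> {}" "carrier V = linspan V S"
    and eq: "\<And>x. x \<in> S \<Longrightarrow> f x = g x"
  shows "f = g"
proof (rule extensionalityI)
  show "f x = g x" if "x \<in> carrier V" for x
  proof -
    have "x \<in> linspan V S" using that assms(6) by simp
    with assms(3,4,5) show ?thesis
    proof (induction rule: linspan_induct)
      case (base a)
      then show ?case by (rule eq)
    next
      case (add a b)
      then show ?case using assms(1,2) assms(6)[symmetric] by (auto simp: semilinear_mapsD)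
    next
      case (smult c a)
      then show ?case using assms(1,2) assms(6)[symmetric] by (auto simp: semilinear_mapsD)
    qed
  qed
qed (use assms in auto)

section \<open>The algebra of the canonical triple\<close>

abbreviation \<theta>s :: "'a tring \<Rightarrow> ('a \<Rightarrow> 'a) set" where
  "\<theta>s E \<equiv> {\<theta> E y z | y z. y \<in> carrier E \<and> z \<in> carrier E}"

lemma E0r_simps:
  "carrier (E0r E) = linspan (endos_op E) (\<theta>s E)"
  "S \<otimes>\<^bsub>E0r E\<^esub> T = compose (carrier E) T S"
  "\<zero>\<^bsub>E0r E\<^esub> = (\<lambda>x\<in>carrier E. \<zero>\<^bsub>E\<^esub>)"
  "S \<oplus>\<^bsub>E0r E\<^esub> T = (\<lambda>x\<in>carrier E. S x \<oplus>\<^bsub>E\<^esub> T x)"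
  "c \<odot>\<^bsub>E0r E\<^esub> T = (\<lambda>x\<in>carrier E. c \<odot>\<^bsub>E\<^esub> T x)"
  "star (E0r E) = E0r_star E"
  by (simp_all add: E0r_def E0r_module_def endos_op_def module.defs star_alg.defs)

lemma E0r_ops: "add (E0r E) = add (endos_op E)" "module.smult (E0r E) = module.smult (endos_op E)"
  by (simp_all add: E0r_def E0r_module_def module.defs star_alg.defs)

lemma endos_op_simps:
  "carrier (endos_op E) = linear_maps E E \<inter> extensional (carrier E)"
  "\<zero>\<^bsub>endos_op E\<^esub> = (\<lambda>x\<in>carrier E. \<zero>\<^bsub>E\<^esub>)"
  "S \<oplus>\<^bsub>endos_op E\<^esub> T = (\<lambda>x\<in>carrier E. S x \<oplus>\<^bsub>E\<^esub> T x)"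
  "c \<odot>\<^bsub>endos_op E\<^esub> T = (\<lambda>x\<in>carrier E. c \<odot>\<^bsub>E\<^esub> T x)"
  by (simp_all add: endos_op_def)

section \<open>The vector space of endomorphisms\<close>

lemma module_endos_op:
  assumes "module complex_ring E"
  shows "module complex_ring (endos_op E)"
proof -
  interpret module complex_ring E by fact
  note vs = smult_closed[simplified] smult_l_distr[simplified] smult_r_distr[simplified]
    smult_assoc1[simplified] smult_one[simplified]
  have lin: "T x \<in> carrier E" "T (x \<oplus>\<^bsub>E\<^esub> y) = T x \<oplus>\<^bsub>E\<^esub> T y" "T (c \<odot>\<^bsub>E\<^esub> x) = c \<odot>\<^bsub>E\<^esub> T x"
    if "T \<in> linear_maps E E" "x \<in> carrier E" "y \<in> carrier E" for T x y c
    using that by (auto simp: semilinear_maps_def)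
  have add_closed: "S \<oplus>\<^bsub>endos_op E\<^esub> T \<in> carrier (endos_op E)"
    if "S \<in> carrier (endos_op E)" "T \<in> carrier (endos_op E)" for S T
    using that unfolding endos_op_simps
    by (auto intro!: semilinear_mapsI simp: vs M.add.m_ac lin)
  \<comment> \<open>A scalar multiple of a linear map is again linear because complex scalars
    commute.\<close>
  have smult_closed: "c \<odot>\<^bsub>endos_op E\<^esub> T \<in> carrier (endos_op E)"
    if "T \<in> carrier (endos_op E)" for T c
    using that unfolding endos_op_simps
    by (auto intro!: semilinear_mapsI simp: vs(1,3) lin) (simp add: mult.commute vs(4)[symmetric] lin)
  have "abelian_group (endos_op E)"
  proof (rule abelian_groupI)
    show "\<zero>\<^bsub>endos_op E\<^esub> \<in> carrier (endos_op E)"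
      using smult_r_null by (auto simp: endos_op_simps intro!: semilinear_mapsI)
  next
    fix T assume T: "T \<in> carrier (endos_op E)"
    show "\<exists>S\<in>carrier (endos_op E). S \<oplus>\<^bsub>endos_op E\<^esub> T = \<zero>\<^bsub>endos_op E\<^esub>"
    proof
      have "(- 1) \<odot>\<^bsub>E\<^esub> T x \<oplus>\<^bsub>E\<^esub> T x = \<zero>\<^bsub>E\<^esub>" if "x \<in> carrier E" for x
      proof -
        have "T x \<in> carrier E" using that T lin(1) by (auto simp: endos_op_simps)
        then show ?thesis
          using vs(2)[of "T x" "- 1" 1] vs(5)[of "T x"] smult_l_null[of "T x"] by simp
      qed
      then show "(- 1) \<odot>\<^bsub>endos_op E\<^esub> T \<oplus>\<^bsub>endos_op E\<^esub> T = \<zero>\<^bsub>endos_op E\<^esub>"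
        by (auto simp: endos_op_simps)
    qed (use smult_closed T in auto)
  next
    show "\<zero>\<^bsub>endos_op E\<^esub> \<oplus>\<^bsub>endos_op E\<^esub> T = T" if "T \<in> carrier (endos_op E)" for T
      using that by (intro extensionalityI[of _ "carrier E"]) (auto simp: endos_op_simps lin)
  next
    show "S \<oplus>\<^bsub>endos_op E\<^esub> T = T \<oplus>\<^bsub>endos_op E\<^esub> S"
      if "S \<in> carrier (endos_op E)" "T \<in> carrier (endos_op E)" for S T
      using that by (auto simp: endos_op_simps lin M.a_comm intro!: restrict_ext)
  next
    show "(S \<oplus>\<^bsub>endos_op E\<^esub> T) \<oplus>\<^bsub>endos_op E\<^esub> U = S \<oplus>\<^bsub>endos_op E\<^esub> (T \<oplus>\<^bsub>endos_op E\<^esub> U)"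
      if "S \<in> carrier (endos_op E)" "T \<in> carrier (endos_op E)" "U \<in> carrier (endos_op E)" for S T U
      using that by (auto simp: endos_op_simps lin M.a_assoc intro!: restrict_ext)
  qed (use add_closed in auto)
  then show ?thesis
  proof (intro moduleI)
    show "c \<odot>\<^bsub>endos_op E\<^esub> T \<in> carrier (endos_op E)" if "T \<in> carrier (endos_op E)" for c T
      using smult_closed that by blast
    show "\<one>\<^bsub>complex_ring\<^esub> \<odot>\<^bsub>endos_op E\<^esub> T = T" if "T \<in> carrier (endos_op E)" for T
      using that by (intro extensionalityI[of _ "carrier E"]) (auto simp: endos_op_simps lin vs)
  qed (auto simp: is_cring endos_op_simps lin vs intro!: restrict_ext)
qed

section \<open>Arithmetic of ternary products\<close>

context star_tring
begin

lemma tprod_closed [simp]: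
  "\<lbrakk>x \<in> carrier E; y \<in> carrier E; z \<in> carrier E\<rbrakk> \<Longrightarrow> tprod E x y z \<in> carrier E"
  by (rule semilinear_mapsD(1)[OF tprod_linear1])

lemma tprod_add:
  assumes "x \<in> carrier E" "x' \<in> carrier E" "y \<in> carrier E" "z \<in> carrier E"
  shows "tprod E (x \<oplus>\<^bsub>E\<^esub> x') y z = tprod E x y z \<oplus>\<^bsub>E\<^esub> tprod E x' y z"
    and "tprod E y (x \<oplus>\<^bsub>E\<^esub> x') z = tprod E y x z \<oplus>\<^bsub>E\<^esub> tprod E y x' z"
    and "tprod E y z (x \<oplus>\<^bsub>E\<^esub> x') = tprod E y z x \<oplus>\<^bsub>E\<^esub> tprod E y z x'"
  using assms tprod_linear1 tprod_antilinear2 tprod_linear3 by (simp_all add: semilinear_maps_def)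

lemma tprod_smult:
  assumes "x \<in> carrier E" "y \<in> carrier E" "z \<in> carrier E"
  shows "tprod E (c \<odot>\<^bsub>E\<^esub> x) y z = c \<odot>\<^bsub>E\<^esub> tprod E x y z"
    and "tprod E x (c \<odot>\<^bsub>E\<^esub> y) z = cnj c \<odot>\<^bsub>E\<^esub> tprod E x y z"
    and "tprod E x y (c \<odot>\<^bsub>E\<^esub> z) = c \<odot>\<^bsub>E\<^esub> tprod E x y z"
  using assms tprod_linear1 tprod_antilinear2 tprod_linear3 by (simp_all add: semilinear_maps_def)

lemma vs_simps:
  "x \<in> carrier E \<Longrightarrow> c \<odot>\<^bsub>E\<^esub> x \<in> carrier E"
  "x \<in> carrier E \<Longrightarrow> (c + d) \<odot>\<^bsub>E\<^esub> x = c \<odot>\<^bsub>E\<^esub> x \<oplus>\<^bsub>E\<^esub> d \<odot>\<^bsub>E\<^esub> x"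
  "\<lbrakk>x \<in> carrier E; y \<in> carrier E\<rbrakk> \<Longrightarrow> c \<odot>\<^bsub>E\<^esub> (x \<oplus>\<^bsub>E\<^esub> y) = c \<odot>\<^bsub>E\<^esub> x \<oplus>\<^bsub>E\<^esub> c \<odot>\<^bsub>E\<^esub> y"
  "x \<in> carrier E \<Longrightarrow> 1 \<odot>\<^bsub>E\<^esub> x = x"
  "x \<in> carrier E \<Longrightarrow> 0 \<odot>\<^bsub>E\<^esub> x = \<zero>\<^bsub>E\<^esub>"
  using smult_closed smult_l_distr smult_r_distr smult_one smult_l_null by simp_all

lemma tprod_zero:
  assumes "x \<in> carrier E" "y \<in> carrier E"
  shows "tprod E \<zero>\<^bsub>E\<^esub> x y = \<zero>\<^bsub>E\<^esub>" "tprod E x \<zero>\<^bsub>E\<^esub> y = \<zero>\<^bsub>E\<^esub>" "tprod E x y \<zero>\<^bsub>E\<^esub> = \<zero>\<^bsub>E\<^esub>"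
  using tprod_smult[of "\<zero>\<^bsub>E\<^esub>" x y 0] tprod_smult[of x "\<zero>\<^bsub>E\<^esub>" y 0] tprod_smult[of x y "\<zero>\<^bsub>E\<^esub>" 0] assms
  by (simp_all add: vs_simps)

text \<open>Differences are written with the scalar -1, so that the rules for sums and scalars in
  each slot of the ternary product, and in spans, apply to them directly.\<close>

lemma eq_if_diff_zero:
  assumes "a \<in> carrier E" "b \<in> carrier E" "a \<oplus>\<^bsub>E\<^esub> (- 1) \<odot>\<^bsub>E\<^esub> b = \<zero>\<^bsub>E\<^esub>"
  shows "a = b"
proof -
  have "b \<oplus>\<^bsub>E\<^esub> (- 1) \<odot>\<^bsub>E\<^esub> b = \<zero>\<^bsub>E\<^esub>"
    using vs_simps(2)[of b 1 "- 1"] assms by (simp add: vs_simps)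
  with assms show ?thesis
    using vs_simps(1)[of b "- 1"] M.add.r_cancel by metis
qed

end

text \<open>The middle slot separates points. For w = a - b, the hypothesis makes (w, a, w) and (w,
  b, w) cancel in (w, w, w), and admissibility gives w = 0.\<close>

lemma (in admissible_star_tring) eq_if_tprod_eq:
  assumes "a \<in> carrier E" "b \<in> carrier E"
    and eq: "\<And>x v. \<lbrakk>x \<in> carrier E; v \<in> carrier E\<rbrakk> \<Longrightarrow> tprod E x a v = tprod E x b v"
  shows "a = b"
proof -
  let ?w = "a \<oplus>\<^bsub>E\<^esub> (- 1) \<odot>\<^bsub>E\<^esub> b"
  have w: "?w \<in> carrier E" using assms by (simp add: vs_simps)
  \<comment> \<open>Only the middle \<open>?w\<close> is expanded. That slot is conjugate linear,
    but -1 is real and comes out unchanged.\<close>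
  have "tprod E ?w ?w ?w = tprod E ?w b ?w \<oplus>\<^bsub>E\<^esub> (- 1) \<odot>\<^bsub>E\<^esub> tprod E ?w b ?w"
    using assms w by (subst tprod_add(2)) (auto simp: vs_simps tprod_smult)
  also have "\<dots> = \<zero>\<^bsub>E\<^esub>"
    using vs_simps(2)[of "tprod E ?w b ?w" 1 "- 1"] assms w by (simp add: vs_simps)
  finally show ?thesis
    by (rule eq_if_diff_zero[OF assms(1,2) admissible[OF w]])
qed

lemma semilinear_maps_cong:
  assumes "carrier V' = carrier V" "add V' = add V" "module.smult V' = module.smult V"
    and "carrier W' = carrier W" "add W' = add W" "module.smult W' = module.smult W"
  shows "semilinear_maps s V' W' = semilinear_maps s V W"
  by (simp add: semilinear_maps_def assms)

text \<open>\<open>E0r_star\<close> is specified over \<open>E0r_module E\<close>, the record before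
  the star field is added. With this and the equality of carriers, its specification can be read
  over \<open>E0r E\<close>.\<close>

lemma E0r_module_maps: "semilinear_maps s (E0r_module E) (E0r_module E) = semilinear_maps s (E0r E) (E0r E)"
  by (rule semilinear_maps_cong) (simp_all add: E0r_def module.defs star_alg.defs)

lemma carrier_E0r_module: "carrier (E0r_module E) = carrier (E0r E)"
  by (simp add: E0r_def module.defs star_alg.defs)

text \<open>Fixes the record type to \<open>'a tring\<close> without further fields, the type on
  which \<open>\<theta>\<close>, \<open>E0r\<close> and \<open>canonical_triple\<close> are
  defined.\<close>

locale canonical = admissible_star_tring E for E :: "'a tring"
begin

lemma module_E: "module complex_ring E"
  by (rule module_axioms)

lemma \<theta>_apply: "x \<in> carrier E \<Longrightarrow> \<theta> E y z x = tprod E x y z"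
  by (simp add: \<theta>_def)

lemma \<theta>_add:
  assumes "x \<in> carrier E" "x' \<in> carrier E" "y \<in> carrier E"
  shows "\<theta> E (x \<oplus>\<^bsub>E\<^esub> x') y = \<theta> E x y \<oplus>\<^bsub>E0r E\<^esub> \<theta> E x' y"
    and "\<theta> E y (x \<oplus>\<^bsub>E\<^esub> x') = \<theta> E y x \<oplus>\<^bsub>E0r E\<^esub> \<theta> E y x'"
  using assms by (auto simp: \<theta>_def E0r_simps(4) tprod_add intro!: restrict_ext)

lemma \<theta>_smult:
  assumes "x \<in> carrier E" "y \<in> carrier E"
  shows "\<theta> E (c \<odot>\<^bsub>E\<^esub> x) y = cnj c \<odot>\<^bsub>E0r E\<^esub> \<theta> E x y"
    and "\<theta> E x (c \<odot>\<^bsub>E\<^esub> y) = c \<odot>\<^bsub>E0r E\<^esub> \<theta> E x y"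
  using assms by (auto simp: \<theta>_def E0r_simps(5) tprod_smult intro!: restrict_ext)

lemma \<theta>_zero: "x \<in> carrier E \<Longrightarrow> \<theta> E x \<zero>\<^bsub>E\<^esub> = \<zero>\<^bsub>E0r E\<^esub>"
  by (auto simp: \<theta>_def E0r_simps(3) tprod_zero intro!: restrict_ext)

lemma \<theta>s_subset_endos: "\<theta>s E \<subseteq> carrier (endos_op E)"
  using tprod_linear1 by (auto simp: \<theta>_def endos_op_simps semilinear_maps_def)

lemma \<theta>s_nonempty: "\<theta>s E \<noteq> {}"
  using M.zero_closed by blast

lemmas \<theta>s_span = module_endos_op[OF module_E] \<theta>s_subset_endos

text \<open>The carrier is a span, hence a submodule of \<open>endos_op E\<close>; the record with
  the star field inherits the axioms by transfer.\<close>

lemma module_E0r: "module complex_ring (E0r E)"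
proof (rule module_transfer[OF submodule.submodule_is_module])
  show "submodule (linspan (endos_op E) (\<theta>s E)) complex_ring (endos_op E)"
    by (rule linspan_submodule[OF \<theta>s_span \<theta>s_nonempty])
qed (auto simp: E0r_simps endos_op_simps fun_eq_iff module_endos_op[OF module_E])

lemma \<theta>_in_E0r: "\<lbrakk>y \<in> carrier E; z \<in> carrier E\<rbrakk> \<Longrightarrow> \<theta> E y z \<in> carrier (E0r E)"
  using linspan_base[OF \<theta>s_span] by (auto simp: E0r_simps)

lemma \<theta>s_subset: "\<theta>s E \<subseteq> carrier (E0r E)"
  using \<theta>_in_E0r by auto

lemma E0r_endos: "carrier (E0r E) \<subseteq> linear_maps E E \<inter> extensional (carrier E)"
  using linspan_subset[OF \<theta>s_span] by (simp add: E0r_simps endos_op_simps)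

lemma E0r_map:
  assumes "T \<in> carrier (E0r E)" "x \<in> carrier E"
  shows "T x \<in> carrier E"
    and "y \<in> carrier E \<Longrightarrow> T (x \<oplus>\<^bsub>E\<^esub> y) = T x \<oplus>\<^bsub>E\<^esub> T y"
    and "T (c \<odot>\<^bsub>E\<^esub> x) = c \<odot>\<^bsub>E\<^esub> T x"
  using assms E0r_endos by (auto simp: semilinear_maps_def)

lemma E0r_ext:
  assumes "S \<in> carrier (E0r E)" "T \<in> carrier (E0r E)" "\<And>x. x \<in> carrier E \<Longrightarrow> S x = T x"
  shows "S = T"
  using assms E0r_endos by (intro extensionalityI[of S "carrier E" T]) auto

lemma E0r_closed:
  "\<lbrakk>S \<in> carrier (E0r E); T \<in> carrier (E0r E)\<rbrakk> \<Longrightarrow> S \<oplus>\<^bsub>E0r E\<^esub> T \<in> carrier (E0r E)"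
  "T \<in> carrier (E0r E) \<Longrightarrow> c \<odot>\<^bsub>E0r E\<^esub> T \<in> carrier (E0r E)"
  "\<zero>\<^bsub>E0r E\<^esub> \<in> carrier (E0r E)"
proof -
  interpret A: module complex_ring "E0r E" by (rule module_E0r)
  show "\<lbrakk>S \<in> carrier (E0r E); T \<in> carrier (E0r E)\<rbrakk> \<Longrightarrow> S \<oplus>\<^bsub>E0r E\<^esub> T \<in> carrier (E0r E)"
    "T \<in> carrier (E0r E) \<Longrightarrow> c \<odot>\<^bsub>E0r E\<^esub> T \<in> carrier (E0r E)"
    "\<zero>\<^bsub>E0r E\<^esub> \<in> carrier (E0r E)"
    using A.smult_closed by simp_all
qed

lemma E0r_induct [consumes 1, case_names base add smult]:
  assumes "T \<in> carrier (E0r E)"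
    and base: "\<And>y z. \<lbrakk>y \<in> carrier E; z \<in> carrier E\<rbrakk> \<Longrightarrow> P (\<theta> E y z)"
    and add: "\<And>S T. \<lbrakk>S \<in> carrier (E0r E); T \<in> carrier (E0r E); P S; P T\<rbrakk> \<Longrightarrow> P (S \<oplus>\<^bsub>E0r E\<^esub> T)"
    and smult: "\<And>c T. \<lbrakk>T \<in> carrier (E0r E); P T\<rbrakk> \<Longrightarrow> P (c \<odot>\<^bsub>E0r E\<^esub> T)"
  shows "P T"
proof -
  have "T \<in> linspan (endos_op E) (\<theta>s E)" using assms(1) by (simp add: E0r_simps)
  with \<theta>s_span \<theta>s_nonempty show ?thesis
  proof (induction rule: linspan_induct)
    case (base T)
    then show ?case using assms(2) by auto
  next
    case (add S T)
    then show ?case using assms(3)[of S T] by (simp add: E0r_simps(1) E0r_ops)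
  next
    case (smult c T)
    then show ?case using assms(4)[of T c] by (simp add: E0r_simps(1) E0r_ops)
  qed
qed

text \<open>The carrier was defined as a span computed in \<open>endos_op E\<close>, whereas
  fullness asks for the span computed in \<open>E0r E\<close> itself. Induction on elements passes
  from one to the other.\<close>

lemma E0r_full: "linspan (E0r E) (\<theta>s E) = carrier (E0r E)"
proof
  show "linspan (E0r E) (\<theta>s E) \<subseteq> carrier (E0r E)"
    by (rule linspan_subset[OF module_E0r \<theta>s_subset])
  show "carrier (E0r E) \<subseteq> linspan (E0r E) (\<theta>s E)"
  proof
    fix T assume "T \<in> carrier (E0r E)"
    then show "T \<in> linspan (E0r E) (\<theta>s E)"
    proof (induction rule: E0r_induct)
      case (base y z)
      then show ?case by (intro linspan_base[OF module_E0r \<theta>s_subset]) auto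
    next
      case (add S T)
      then show ?case by (intro linspan_add[OF module_E0r \<theta>s_subset])
    next
      case (smult c T)
      then show ?case by (intro linspan_smult[OF module_E0r \<theta>s_subset])
    qed
  qed
qed

text \<open>The uniqueness behind both definite descriptions, of the involution (\<open>s\<close>
  being \<open>cnj\<close>) and of the induced homomorphism (\<open>s\<close> being the
  identity).\<close>

lemma maps_E0r_eqI:
  assumes "f \<in> semilinear_maps s (E0r E) W \<inter> extensional (carrier (E0r E))"
    and "g \<in> semilinear_maps s (E0r E) W \<inter> extensional (carrier (E0r E))"
    and "\<And>y z. \<lbrakk>y \<in> carrier E; z \<in> carrier E\<rbrakk> \<Longrightarrow> f (\<theta> E y z) = g (\<theta> E y z)"
  shows "f = g"
  by (rule semilinear_maps_eqI[OF assms(1,2) module_E0r \<theta>s_subset \<theta>s_nonempty E0r_full[symmetric]])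
    (use assms(3) in auto)

text \<open>Adjointness for the operator-valued form that sends x and u to the map v \<mapsto> (x,
  u, v). Both equations are required so that the relation is symmetric by definition.\<close>

definition adjoint :: "('a \<Rightarrow> 'a) \<Rightarrow> ('a \<Rightarrow> 'a) \<Rightarrow> bool" where
  "adjoint S T \<longleftrightarrow> (\<forall>x\<in>carrier E. \<forall>u\<in>carrier E. \<forall>v\<in>carrier E.
     tprod E (S x) u v = tprod E x (T u) v \<and> tprod E (T x) u v = tprod E x (S u) v)"

lemma adjointD:
  assumes "adjoint S T" "x \<in> carrier E" "u \<in> carrier E" "v \<in> carrier E"
  shows "tprod E (S x) u v = tprod E x (T u) v" "tprod E (T x) u v = tprod E x (S u) v"
  using assms by (auto simp: adjoint_def)

lemma adjoint_sym: "adjoint S T \<Longrightarrow> adjoint T S"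
  by (simp add: adjoint_def)

text \<open>The operator \<open>S\<close> prescribes every product with \<open>T x\<close> in the
  middle slot, and the middle slot separates points.\<close>

lemma adjoint_unique:
  assumes "T \<in> carrier (E0r E)" "T' \<in> carrier (E0r E)" "adjoint S T" "adjoint S T'"
  shows "T = T'"
proof (rule E0r_ext[OF assms(1,2)])
  fix x assume x: "x \<in> carrier E"
  show "T x = T' x"
  proof (rule eq_if_tprod_eq)
    show "tprod E y (T x) v = tprod E y (T' x) v" if "y \<in> carrier E" "v \<in> carrier E" for y v
      using adjointD(1)[OF assms(3) that(1) x that(2)] adjointD(1)[OF assms(4) that(1) x that(2)]
      by simp
  qed (use assms x E0r_map in auto)
qed

text \<open>Both halves are instances of ((x, y, z), u, v) = (x, (u, z, y), v), since (u, z, y) is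
  the value of \<open>\<theta> E z y\<close> at u.\<close>

lemma adjoint_\<theta>: "\<lbrakk>y \<in> carrier E; z \<in> carrier E\<rbrakk> \<Longrightarrow> adjoint (\<theta> E y z) (\<theta> E z y)"
  by (simp add: adjoint_def \<theta>_apply tprod_assoc1)

lemma adjoint_add:
  assumes "S \<in> carrier (E0r E)" "S' \<in> carrier (E0r E)" "T \<in> carrier (E0r E)" "T' \<in> carrier (E0r E)"
    and "adjoint S T" "adjoint S' T'"
  shows "adjoint (S \<oplus>\<^bsub>E0r E\<^esub> S') (T \<oplus>\<^bsub>E0r E\<^esub> T')"
  unfolding adjoint_def
proof (intro ballI)
  fix x u v assume xuv: "x \<in> carrier E" "u \<in> carrier E" "v \<in> carrier E"
  then show "tprod E ((S \<oplus>\<^bsub>E0r E\<^esub> S') x) u v = tprod E x ((T \<oplus>\<^bsub>E0r E\<^esub> T') u) v \<and>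
      tprod E ((T \<oplus>\<^bsub>E0r E\<^esub> T') x) u v = tprod E x ((S \<oplus>\<^bsub>E0r E\<^esub> S') u) v"
    using adjointD[OF assms(5) xuv] adjointD[OF assms(6) xuv] assms(1-4)
    by (simp add: E0r_simps(4) tprod_add E0r_map)
qed

text \<open>The adjoint acts in the conjugate linear slot, so the scalar has to be conjugated there
  to come out as \<open>c\<close>.\<close>

lemma adjoint_smult:
  assumes "S \<in> carrier (E0r E)" "T \<in> carrier (E0r E)" "adjoint S T"
  shows "adjoint (c \<odot>\<^bsub>E0r E\<^esub> S) (cnj c \<odot>\<^bsub>E0r E\<^esub> T)"
  unfolding adjoint_def
proof (intro ballI)
  fix x u v assume xuv: "x \<in> carrier E" "u \<in> carrier E" "v \<in> carrier E"
  then show "tprod E ((c \<odot>\<^bsub>E0r E\<^esub> S) x) u v = tprod E x ((cnj c \<odot>\<^bsub>E0r E\<^esub> T) u) v \<and>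
      tprod E ((cnj c \<odot>\<^bsub>E0r E\<^esub> T) x) u v = tprod E x ((c \<odot>\<^bsub>E0r E\<^esub> S) u) v"
    using adjointD[OF assms(3) xuv] assms(1,2)
    by (simp add: E0r_simps(5) tprod_smult E0r_map)
qed

lemma adjoint_exists:
  assumes "S \<in> carrier (E0r E)"
  shows "\<exists>T\<in>carrier (E0r E). adjoint S T"
  using assms
proof (induction rule: E0r_induct)
  case (base y z)
  then show ?case using adjoint_\<theta> \<theta>_in_E0r by blast
next
  case (add S S')
  then obtain T T' where "T \<in> carrier (E0r E)" "adjoint S T" "T' \<in> carrier (E0r E)" "adjoint S' T'"
    by blast
  then show ?case using add by (intro bexI[of _ "T \<oplus>\<^bsub>E0r E\<^esub> T'"] adjoint_add E0r_closed)
next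
  case (smult c S)
  then obtain T where "T \<in> carrier (E0r E)" "adjoint S T" by blast
  then show ?case using smult by (intro bexI[of _ "cnj c \<odot>\<^bsub>E0r E\<^esub> T"] adjoint_smult E0r_closed)
qed

text \<open>Resolves the definite description in \<open>E0r_star\<close>. The third fact, that the
  star of every element is its adjoint, is what the later proofs rely on.\<close>

lemma star_E0r:
  "star (E0r E) \<in> antilinear_maps (E0r E) (E0r E) \<inter> extensional (carrier (E0r E))"
  "\<lbrakk>y \<in> carrier E; z \<in> carrier E\<rbrakk> \<Longrightarrow> star (E0r E) (\<theta> E y z) = \<theta> E z y"
  "T \<in> carrier (E0r E) \<Longrightarrow> adjoint T (star (E0r E) T)"
proof -
  let ?Q = "\<lambda>j. j \<in> antilinear_maps (E0r E) (E0r E) \<inter> extensional (carrier (E0r E)) \<and>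
     (\<forall>y\<in>carrier E. \<forall>z\<in>carrier E. j (\<theta> E y z) = \<theta> E z y)"
  have "\<exists>j \<in> antilinear_maps (E0r E) (E0r E) \<inter> extensional (carrier (E0r E)).
      \<forall>T\<in>carrier (E0r E). adjoint T (j T)"
    by (rule semilinear_map_exists[OF module_E0r])
      (use adjoint_exists adjoint_unique in \<open>auto simp: E0r_closed adjoint_add adjoint_smult\<close>)
  then obtain j where j: "j \<in> antilinear_maps (E0r E) (E0r E) \<inter> extensional (carrier (E0r E))"
    "\<And>T. T \<in> carrier (E0r E) \<Longrightarrow> adjoint T (j T)"
    by blast
  \<comment> \<open>The map \<open>j\<close> is known only through adjointness; its values on
    generators follow because \<open>\<theta> E z y\<close> is also adjoint to
    \<open>\<theta> E y z\<close>.\<close>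
  have j_\<theta>: "j (\<theta> E y z) = \<theta> E z y" if "y \<in> carrier E" "z \<in> carrier E" for y z
    using j that \<theta>_in_E0r adjoint_\<theta> by (intro adjoint_unique[of _ _ "\<theta> E y z"]) (auto simp: semilinear_maps_def)
  have "E0r_star E = j"
    unfolding E0r_star_def E0r_module_maps carrier_E0r_module
  proof (rule the_equality)
    show "?Q j" using j j_\<theta> by blast
    show "k = j" if "?Q k" for k
      using that j(1) j_\<theta> by (intro maps_E0r_eqI[of k cnj "E0r E" j]) auto
  qed
  then show "star (E0r E) \<in> antilinear_maps (E0r E) (E0r E) \<inter> extensional (carrier (E0r E))"
    "\<lbrakk>y \<in> carrier E; z \<in> carrier E\<rbrakk> \<Longrightarrow> star (E0r E) (\<theta> E y z) = \<theta> E z y"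
    "T \<in> carrier (E0r E) \<Longrightarrow> adjoint T (star (E0r E) T)"
    using j j_\<theta> by (simp_all add: E0r_simps(6))
qed

lemma star_E0r_closed: "T \<in> carrier (E0r E) \<Longrightarrow> star (E0r E) T \<in> carrier (E0r E)"
  using star_E0r(1) by (auto simp: semilinear_maps_def)

section \<open>The product, the involution laws and admissibility\<close>

lemma mult_apply: "x \<in> carrier E \<Longrightarrow> (S \<otimes>\<^bsub>E0r E\<^esub> T) x = T (S x)"
  by (simp add: E0r_simps compose_def)

text \<open>Amounts to T (x, y, z) = (x, y, T z) for \<open>T\<close> in the span. On a generator
  this is ((x, y, z), u, v) = (x, y, (z, u, v)), obtained by chaining the two associativity axioms;
  both sides are linear in \<open>T\<close>. It yields closure under products as well as the
  compatibility of inner product and action.\<close>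

lemma \<theta>_mult:
  assumes "y \<in> carrier E" "z \<in> carrier E" "T \<in> carrier (E0r E)"
  shows "\<theta> E y z \<otimes>\<^bsub>E0r E\<^esub> T = \<theta> E y (T z)"
proof -
  have "T (tprod E x y z) = tprod E x y (T z)" if "x \<in> carrier E" for x
    using assms(3)
  proof (induction rule: E0r_induct)
    case (base u v)
    then show ?case using that assms by (simp add: \<theta>_apply tprod_assoc1 tprod_assoc2)
  next
    case (add S T)
    then show ?case using that assms by (simp add: E0r_simps(4) E0r_map tprod_add)
  next
    case (smult c T)
    then show ?case using that assms by (simp add: E0r_simps(5) E0r_map tprod_smult)
  qed
  then show ?thesis by (auto simp: E0r_simps(2) compose_def \<theta>_def)
qed

lemma mult_add_distrib:
  assumes "R \<in> carrier (E0r E)" "S \<in> carrier (E0r E)" "T \<in> carrier (E0r E)"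
  shows "(R \<oplus>\<^bsub>E0r E\<^esub> S) \<otimes>\<^bsub>E0r E\<^esub> T = R \<otimes>\<^bsub>E0r E\<^esub> T \<oplus>\<^bsub>E0r E\<^esub> S \<otimes>\<^bsub>E0r E\<^esub> T"
    and "T \<otimes>\<^bsub>E0r E\<^esub> (R \<oplus>\<^bsub>E0r E\<^esub> S) = T \<otimes>\<^bsub>E0r E\<^esub> R \<oplus>\<^bsub>E0r E\<^esub> T \<otimes>\<^bsub>E0r E\<^esub> S"
  using assms by (auto simp: E0r_simps(2,4) compose_def E0r_map intro!: restrict_ext)

lemma mult_smult:
  assumes "S \<in> carrier (E0r E)" "T \<in> carrier (E0r E)"
  shows "(c \<odot>\<^bsub>E0r E\<^esub> S) \<otimes>\<^bsub>E0r E\<^esub> T = c \<odot>\<^bsub>E0r E\<^esub> (S \<otimes>\<^bsub>E0r E\<^esub> T)"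
    and "S \<otimes>\<^bsub>E0r E\<^esub> (c \<odot>\<^bsub>E0r E\<^esub> T) = c \<odot>\<^bsub>E0r E\<^esub> (S \<otimes>\<^bsub>E0r E\<^esub> T)"
  using assms by (auto simp: E0r_simps(2,5) compose_def E0r_map intro!: restrict_ext)

text \<open>Induction on the left factor suffices: by \<open>\<theta>_mult\<close> a generator
  absorbs any right factor and stays a generator.\<close>

lemma mult_closed:
  assumes "S \<in> carrier (E0r E)" "T \<in> carrier (E0r E)"
  shows "S \<otimes>\<^bsub>E0r E\<^esub> T \<in> carrier (E0r E)"
  using assms(1)
proof (induction rule: E0r_induct)
  case (base y z)
  then show ?case using assms(2) by (simp add: \<theta>_mult \<theta>_in_E0r E0r_map)
qed (use assms(2) in \<open>simp_all add: mult_add_distrib mult_smult E0r_closed\<close>)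

lemma star_algebra_E0r: "star_algebra (E0r E)"
proof (intro star_algebra.intro star_algebra_axioms.intro)
  show "module complex_ring (E0r E)" by (rule module_E0r)
  show "(\<lambda>S. S \<otimes>\<^bsub>E0r E\<^esub> T) \<in> linear_maps (E0r E) (E0r E)"
    "(\<lambda>S. T \<otimes>\<^bsub>E0r E\<^esub> S) \<in> linear_maps (E0r E) (E0r E)" if "T \<in> carrier (E0r E)" for T
    using that by (auto intro!: semilinear_mapsI simp: mult_closed mult_add_distrib mult_smult)
  show "(R \<otimes>\<^bsub>E0r E\<^esub> S) \<otimes>\<^bsub>E0r E\<^esub> T = R \<otimes>\<^bsub>E0r E\<^esub> (S \<otimes>\<^bsub>E0r E\<^esub> T)"
    if "R \<in> carrier (E0r E)" "S \<in> carrier (E0r E)" "T \<in> carrier (E0r E)" for R S T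
    using that by (auto simp: E0r_simps(2) compose_def E0r_map intro!: restrict_ext)
  show "star (E0r E) \<in> antilinear_maps (E0r E) (E0r E)" using star_E0r(1) by simp
  \<comment> \<open>By symmetry \<open>T\<close> is itself an adjoint of its star, and adjoints are
    unique.\<close>
  show star_star: "star (E0r E) (star (E0r E) T) = T" if "T \<in> carrier (E0r E)" for T
    using that star_E0r_closed star_E0r(3) adjoint_sym adjoint_unique by metis
  show "star (E0r E) (S \<otimes>\<^bsub>E0r E\<^esub> T) = star (E0r E) T \<otimes>\<^bsub>E0r E\<^esub> star (E0r E) S"
    if "S \<in> carrier (E0r E)" "T \<in> carrier (E0r E)" for S T
  proof (rule adjoint_unique)
    \<comment> \<open>The product applies \<open>S\<close> first and then \<open>T\<close>. Moving
      them to the middle slot one at a time gives (T (S x), u, v) = (S x, T* u, v) = (x, S* (T* u),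
      v).\<close>
    show "adjoint (S \<otimes>\<^bsub>E0r E\<^esub> T) (star (E0r E) T \<otimes>\<^bsub>E0r E\<^esub> star (E0r E) S)"
      using that star_E0r_closed
      by (simp add: adjoint_def mult_apply E0r_map adjointD[OF star_E0r(3)] star_star)
  qed (use that in \<open>auto simp: star_E0r_closed mult_closed intro: star_E0r(3)\<close>)
qed

lemma E0r_admissible:
  assumes T: "T \<in> carrier (E0r E)" and "star (E0r E) T \<otimes>\<^bsub>E0r E\<^esub> T = \<zero>\<^bsub>E0r E\<^esub>"
  shows "T = \<zero>\<^bsub>E0r E\<^esub>"
proof -
  interpret A: star_algebra "E0r E" by (rule star_algebra_E0r)
  let ?T = "star (E0r E) T"
  have T': "?T \<in> carrier (E0r E)" using T by (rule star_E0r_closed)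
  have "?T x = \<zero>\<^bsub>E\<^esub>" if x: "x \<in> carrier E" for x
  proof (rule admissible)
    show "?T x \<in> carrier E" using T' x by (rule E0r_map)
    \<comment> \<open>The middle \<open>?T\<close> is moved back to the first slot as
      \<open>T\<close>. There it meets \<open>?T x\<close>, and \<open>T (?T x)\<close> is the value
      at \<open>x\<close> of the product assumed to vanish, the product being opposite to
      composition.\<close>
    have "tprod E (?T x) (?T x) (?T x) = tprod E (T (?T x)) x (?T x)"
      using adjointD(1)[OF star_E0r(3)[OF T], of "?T x" x "?T x"] x E0r_map(1)[OF T'] by simp
    also have "T (?T x) = \<zero>\<^bsub>E\<^esub>"
      using assms(2) x mult_apply[OF x, of ?T T] by (simp add: E0r_simps(3))
    finally show "tprod E (?T x) (?T x) (?T x) = \<zero>\<^bsub>E\<^esub>"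
      using x E0r_map(1)[OF T' x] by (simp add: tprod_zero)
  qed
  then have "?T = \<zero>\<^bsub>E0r E\<^esub>"
    using T' E0r_closed(3) by (intro E0r_ext) (auto simp: E0r_simps(3))
  \<comment> \<open>So far only the star of \<open>T\<close> is known to vanish; the involution
    carries this back to \<open>T\<close>.\<close>
  then have "star (E0r E) ?T = \<zero>\<^bsub>E0r E\<^esub>"
    using semilinear_maps_zero[OF A.star_antilinear] module_E0r by simp
  then show ?thesis using A.star_star[OF T] by simp
qed

section \<open>The canonical triple is admissible and full\<close>

lemma module_truncate: "module complex_ring (module.truncate E)"
  by (rule module_transfer[OF module_E]) (simp_all add: module.defs)

lemma admissible_full_canonical_triple: "admissible_full_basic_triple (canonical_triple E)"
proof -
  have sp: "carrier (module.truncate E) = carrier E" "add (module.truncate E) = add E"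
    "module.smult (module.truncate E) = module.smult E"
    by (simp_all add: module.defs)
  have simps: "space (canonical_triple E) = module.truncate E" "alg (canonical_triple E) = E0r E"
    "act (canonical_triple E) x T = T x" "ip (canonical_triple E) = \<theta> E" for x T
    by (simp_all add: canonical_triple_def)
  interpret A: star_algebra "E0r E" by (rule star_algebra_E0r)
  show ?thesis
  proof (intro admissible_full_basic_triple.intro admissible_full_basic_triple_axioms.intro
      basic_triple.intro basic_triple_axioms.intro admissible_star_algebra.intro
      admissible_star_algebra_axioms.intro, unfold simps sp)
    show "linspan (E0r E) (\<theta>s E) = carrier (E0r E)" by (rule E0r_full)
    show "(\<lambda>x. \<theta> E x y) \<in> antilinear_maps (module.truncate E) (E0r E)" if "y \<in> carrier E" for y
      using that by (auto intro!: semilinear_mapsI simp: sp \<theta>_in_E0r \<theta>_add \<theta>_smult)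
    show "(\<lambda>y. \<theta> E x y) \<in> linear_maps (module.truncate E) (E0r E)" if "x \<in> carrier E" for x
      using that by (auto intro!: semilinear_mapsI simp: sp \<theta>_in_E0r \<theta>_add \<theta>_smult)
    show "(\<lambda>T. T x) \<in> linear_maps (E0r E) (module.truncate E)" if "x \<in> carrier E" for x
      using that by (auto intro!: semilinear_mapsI simp: sp E0r_map E0r_simps(4,5))
    show "(\<lambda>x. T x) \<in> linear_maps (module.truncate E) (module.truncate E)"
      if "T \<in> carrier (E0r E)" for T
      using that by (auto intro!: semilinear_mapsI simp: sp E0r_map)
  qed (use module_truncate star_algebra_E0r E0r_admissible in
      \<open>simp_all add: mult_apply \<theta>_mult star_E0r(2)\<close>)
qed

end

section \<open>The induced homomorphism\<close>

lemma linear_maps_ident: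
  "(\<lambda>x\<in>carrier V. x) \<in> linear_maps V V" if "module complex_ring V"
proof -
  interpret module complex_ring V by fact
  show ?thesis using smult_closed by (auto intro!: semilinear_mapsI)
qed

lemma linear_maps_compose:
  assumes "module complex_ring U" "f \<in> linear_maps U V" "g \<in> linear_maps V W"
  shows "compose (carrier U) g f \<in> linear_maps U W"
proof -
  interpret module complex_ring U by fact
  show ?thesis
    using assms(2,3) smult_closed
    by (intro semilinear_mapsI) (auto simp: compose_eq semilinear_mapsD[of f] semilinear_mapsD[of g])
qed

lemma tring_homs_ident:
  assumes "star_tring E"
  shows "(\<lambda>x\<in>carrier E. x) \<in> tring_homs E E"
proof -
  interpret star_tring E by fact
  show ?thesis using linear_maps_ident[OF module_axioms] by (auto simp: tring_homs_def)
qed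

lemma tring_homs_compose:
  assumes "star_tring E" "f \<in> tring_homs E F" "g \<in> tring_homs F G"
  shows "compose (carrier E) g f \<in> tring_homs E G"
proof -
  interpret star_tring E by fact
  show ?thesis
    using linear_maps_compose[OF module_axioms, of f F g G] assms(2,3)
    by (auto simp: tring_homs_def compose_eq semilinear_mapsD(1)[of f])
qed

lemma star_alg_homs_ident:
  assumes "star_algebra A"
  shows "(\<lambda>a\<in>carrier A. a) \<in> star_alg_homs A A"
proof -
  interpret star_algebra A by fact
  show ?thesis
    using linear_maps_ident[OF module_axioms] semilinear_mapsD(1)[OF star_antilinear]
      semilinear_mapsD(1)[OF mult_linear1]
    by (auto simp: star_alg_homs_def)
qed

lemma star_alg_homs_compose:
  assumes "star_algebra A" "f \<in> star_alg_homs A B" "g \<in> star_alg_homs B C"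
  shows "compose (carrier A) g f \<in> star_alg_homs A C"
proof -
  interpret star_algebra A by fact
  show ?thesis
    using linear_maps_compose[OF module_axioms, of f B g C] assms(2,3)
      semilinear_mapsD(1)[OF star_antilinear] semilinear_mapsD(1)[OF mult_linear1]
    by (auto simp: star_alg_homs_def compose_eq semilinear_mapsD(1)[of f])
qed

section \<open>Construction of the homomorphism induced by \<open>p\<close>\<close>

locale canonical_hom = E: canonical E + F: canonical F
  for E :: "'a tring" and F :: "'b tring" +
  fixes p :: "'a \<Rightarrow> 'b"
  assumes p: "p \<in> tring_homs E F"
begin

lemma p_map:
  "x \<in> carrier E \<Longrightarrow> p x \<in> carrier F"
  "\<lbrakk>x \<in> carrier E; y \<in> carrier E\<rbrakk> \<Longrightarrow> p (x \<oplus>\<^bsub>E\<^esub> y) = p x \<oplus>\<^bsub>F\<^esub> p y"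
  "x \<in> carrier E \<Longrightarrow> p (c \<odot>\<^bsub>E\<^esub> x) = c \<odot>\<^bsub>F\<^esub> p x"
  "\<lbrakk>x \<in> carrier E; y \<in> carrier E; z \<in> carrier E\<rbrakk> \<Longrightarrow> p (tprod E x y z) = tprod F (p x) (p y) (p z)"
  using p by (auto simp: tring_homs_def semilinear_maps_def)

definition \<theta>ps :: "('b \<Rightarrow> 'b) set" where
  "\<theta>ps = {\<theta> F (p x) (p y) | x y. x \<in> carrier E \<and> y \<in> carrier E}"

lemma \<theta>ps_subset: "\<theta>ps \<subseteq> carrier (E0r F)"
  by (auto simp: \<theta>ps_def intro!: F.\<theta>_in_E0r p_map)

lemma \<theta>ps_nonempty: "\<theta>ps \<noteq> {}"
  using E.M.zero_closed by (auto simp: \<theta>ps_def)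

lemmas \<theta>ps_span = F.module_E0r \<theta>ps_subset

text \<open>\<open>D\<close> stays fixed while the induction runs over \<open>S\<close>. For S =
  \<theta>(p x, p y) the product is \<theta>(p y, p x) D = \<theta>(p y, D (p x)) = \<theta>(p y, 0)
  = 0.\<close>

lemma star_mult_eq_zero:
  assumes D: "D \<in> carrier (E0r F)" and van: "\<And>x. x \<in> carrier E \<Longrightarrow> D (p x) = \<zero>\<^bsub>F\<^esub>"
    and S: "S \<in> linspan (E0r F) \<theta>ps"
  shows "star (E0r F) S \<otimes>\<^bsub>E0r F\<^esub> D = \<zero>\<^bsub>E0r F\<^esub>"
  using \<theta>ps_span \<theta>ps_nonempty S
proof (induction rule: linspan_induct)
  interpret A: star_algebra "E0r F" by (rule F.star_algebra_E0r)
  note sub = linspan_subset[OF \<theta>ps_span]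
  note star_map = semilinear_mapsD[OF A.star_antilinear]
  {
    case (base S)
    then show ?case
      using D by (auto simp: \<theta>ps_def p_map F.star_E0r(2) F.\<theta>_mult van F.\<theta>_zero)
  next
    case (add S T)
    then have "S \<in> carrier (E0r F)" "T \<in> carrier (E0r F)" using sub by auto
    then show ?case using add D by (simp add: star_map F.mult_add_distrib)
  next
    case (smult c S)
    then have "S \<in> carrier (E0r F)" using sub by auto
    then show ?case using smult D A.smult_r_null by (simp add: star_map F.mult_smult)
  }
qed

text \<open>The preceding product with S = D is D* D, so admissibility of \<open>E0r F\<close>
  applies.\<close>

lemma eq_zero_if_vanishing_on_range:
  assumes "D \<in> linspan (E0r F) \<theta>ps" and "\<And>x. x \<in> carrier E \<Longrightarrow> D (p x) = \<zero>\<^bsub>F\<^esub>"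
  shows "D = \<zero>\<^bsub>E0r F\<^esub>"
proof -
  have "D \<in> carrier (E0r F)" using assms(1) linspan_subset[OF \<theta>ps_span] by auto
  then show ?thesis
    using F.E0r_admissible star_mult_eq_zero assms by blast
qed

text \<open>Membership in the span of \<open>\<theta>ps\<close> is what makes \<open>T\<close>
  unique. The intertwining equation alone constrains \<open>T\<close> only on the range of
  \<open>p\<close>: for p = 0 every element of \<open>E0r F\<close> satisfies it.\<close>

definition induced :: "('a \<Rightarrow> 'a) \<Rightarrow> ('b \<Rightarrow> 'b) \<Rightarrow> bool" where
  "induced S T \<longleftrightarrow> T \<in> linspan (E0r F) \<theta>ps \<and> (\<forall>x\<in>carrier E. T (p x) = p (S x))"

lemma induced_in: "induced S T \<Longrightarrow> T \<in> carrier (E0r F)"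
  using linspan_subset[OF \<theta>ps_span] by (auto simp: induced_def)

text \<open>The difference of two candidates lies in the span of \<open>\<theta>ps\<close> and
  vanishes on the range of \<open>p\<close>, hence is zero on all of \<open>F\<close>.\<close>

lemma induced_unique:
  assumes S: "S \<in> carrier (E0r E)" and ind: "induced S T" "induced S T'"
  shows "T = T'"
proof -
  let ?D = "T \<oplus>\<^bsub>E0r F\<^esub> (- 1) \<odot>\<^bsub>E0r F\<^esub> T'"
  have "?D (p x) = \<zero>\<^bsub>F\<^esub>" if "x \<in> carrier E" for x
    using that ind S F.vs_simps(2)[of "p (S x)" 1 "- 1"]
    by (simp add: induced_def E0r_simps(4,5) p_map E.E0r_map F.vs_simps)
  then have D: "?D = \<zero>\<^bsub>E0r F\<^esub>"
    using ind by (intro eq_zero_if_vanishing_on_range)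
      (auto simp: induced_def intro!: linspan_add linspan_smult \<theta>ps_span)
  show ?thesis
  proof (rule F.E0r_ext)
    fix x assume x: "x \<in> carrier F"
    have "T x \<in> carrier F" "T' x \<in> carrier F"
      using x ind by (auto intro: F.E0r_map induced_in)
    then show "T x = T' x"
      by (rule F.eq_if_diff_zero) (use fun_cong[OF D, of x] x in \<open>simp add: E0r_simps(3-5)\<close>)
  qed (use ind induced_in in auto)
qed

lemma induced_\<theta>: "\<lbrakk>x \<in> carrier E; y \<in> carrier E\<rbrakk> \<Longrightarrow> induced (\<theta> E x y) (\<theta> F (p x) (p y))"
  by (auto simp: induced_def \<theta>ps_def p_map E.\<theta>_apply F.\<theta>_apply
      intro!: linspan_base[OF \<theta>ps_span, unfolded \<theta>ps_def])

lemma induced_add: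
  assumes "S \<in> carrier (E0r E)" "S' \<in> carrier (E0r E)" "induced S T" "induced S' T'"
  shows "induced (S \<oplus>\<^bsub>E0r E\<^esub> S') (T \<oplus>\<^bsub>E0r F\<^esub> T')"
  using assms linspan_add[OF \<theta>ps_span, of T T']
  by (simp add: induced_def E0r_simps(4) p_map E.E0r_map)

lemma induced_smult:
  assumes "S \<in> carrier (E0r E)" "induced S T"
  shows "induced (c \<odot>\<^bsub>E0r E\<^esub> S) (c \<odot>\<^bsub>E0r F\<^esub> T)"
  using assms linspan_smult[OF \<theta>ps_span, of T c]
  by (simp add: induced_def E0r_simps(5) p_map E.E0r_map)

lemma induced_exists: "S \<in> carrier (E0r E) \<Longrightarrow> \<exists>T. induced S T"
proof (induction rule: E.E0r_induct)
  case (base y z)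
  then show ?case using induced_\<theta> by blast
next
  case (add S T)
  then show ?case using induced_add by blast
next
  case (smult c T)
  then show ?case using induced_smult by blast
qed

lemma star_alg_homs_E0r_unique:
  assumes "q \<in> star_alg_homs (E0r E) (E0r F)" "q' \<in> star_alg_homs (E0r E) (E0r F)"
    and "\<And>x y. \<lbrakk>x \<in> carrier E; y \<in> carrier E\<rbrakk> \<Longrightarrow> q (\<theta> E x y) = q' (\<theta> E x y)"
  shows "q = q'"
  by (rule E.maps_E0r_eqI[of _ _ "E0r F"]) (use assms in \<open>auto simp: star_alg_homs_def\<close>)

text \<open>The third fact records the intertwining relation used in the construction; it is the
  compatibility with actions that a homomorphism of triples needs.\<close>

lemma pi0r:
  "pi0r E F p \<in> star_alg_homs (E0r E) (E0r F)"
  "\<lbrakk>x \<in> carrier E; y \<in> carrier E\<rbrakk> \<Longrightarrow> pi0r E F p (\<theta> E x y) = \<theta> F (p x) (p y)"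
  "\<lbrakk>S \<in> carrier (E0r E); x \<in> carrier E\<rbrakk> \<Longrightarrow> pi0r E F p S (p x) = p (S x)"
proof -
  interpret A: star_algebra "E0r E" by (rule E.star_algebra_E0r)
  interpret B: star_algebra "E0r F" by (rule F.star_algebra_E0r)
  have "\<exists>q \<in> linear_maps (E0r E) (E0r F) \<inter> extensional (carrier (E0r E)).
      \<forall>S\<in>carrier (E0r E). induced S (q S)"
  proof (rule semilinear_map_exists[OF E.module_E0r])
    show "\<exists>T\<in>carrier (E0r F). induced S T" if "S \<in> carrier (E0r E)" for S
      using induced_exists[OF that] induced_in by blast
  qed (use induced_unique in \<open>simp_all add: F.E0r_closed induced_add induced_smult\<close>)
  then obtain q where q: "q \<in> linear_maps (E0r E) (E0r F) \<inter> extensional (carrier (E0r E))"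
    and ind: "\<And>S. S \<in> carrier (E0r E) \<Longrightarrow> induced S (q S)"
    by blast
  have q_map: "q S \<in> carrier (E0r F)" "q (S \<oplus>\<^bsub>E0r E\<^esub> T) = q S \<oplus>\<^bsub>E0r F\<^esub> q T"
    "q (c \<odot>\<^bsub>E0r E\<^esub> S) = c \<odot>\<^bsub>E0r F\<^esub> q S"
    if "S \<in> carrier (E0r E)" "T \<in> carrier (E0r E)" for S T c
    using q that by (auto simp: semilinear_maps_def)
  have q_\<theta>: "q (\<theta> E x y) = \<theta> F (p x) (p y)" if "x \<in> carrier E" "y \<in> carrier E" for x y
    using that by (intro induced_unique[OF E.\<theta>_in_E0r ind induced_\<theta>] E.\<theta>_in_E0r)
  have q_act: "q S (p x) = p (S x)" if "S \<in> carrier (E0r E)" "x \<in> carrier E" for S x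
    using ind that by (auto simp: induced_def)
  \<comment> \<open>On a left factor \<theta>(y, z), both sides become \<theta>(p y, p (T z)): one
    by \<open>\<theta>_mult\<close> in \<open>E\<close>, the other by \<open>\<theta>_mult\<close>
    in \<open>F\<close> together with q T (p z) = p (T z).\<close>
  have q_mult: "q (S \<otimes>\<^bsub>E0r E\<^esub> T) = q S \<otimes>\<^bsub>E0r F\<^esub> q T"
    if "S \<in> carrier (E0r E)" "T \<in> carrier (E0r E)" for S T
    using that(1)
  proof (induction rule: E.E0r_induct)
    case (base y z)
    then show ?case
      using that(2) by (simp add: E.\<theta>_mult q_\<theta> E.E0r_map F.\<theta>_mult q_map p_map q_act)
  qed (use that(2) in \<open>simp_all add: E.mult_add_distrib F.mult_add_distrib E.mult_smult F.mult_smult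
      q_map E.mult_closed\<close>)
  \<comment> \<open>Both sides are antilinear in \<open>S\<close>, and on \<theta>(y, z) both give
    \<theta>(p z, p y).\<close>
  have q_star: "q (star (E0r E) S) = star (E0r F) (q S)" if "S \<in> carrier (E0r E)" for S
    using that
  proof (induction rule: E.E0r_induct)
    case (base y z)
    then show ?case by (simp add: E.star_E0r(2) F.star_E0r(2) q_\<theta> p_map)
  qed (simp_all add: semilinear_mapsD[OF A.star_antilinear] semilinear_mapsD[OF B.star_antilinear]
      q_map)
  have q_hom: "q \<in> star_alg_homs (E0r E) (E0r F)"
    using q q_mult q_star by (simp add: star_alg_homs_def)
  have "pi0r E F p = q"
    unfolding pi0r_def
    by (rule the_equality) (use q_hom q_\<theta> in \<open>auto intro: star_alg_homs_E0r_unique\<close>)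
  then show "pi0r E F p \<in> star_alg_homs (E0r E) (E0r F)"
    "\<lbrakk>x \<in> carrier E; y \<in> carrier E\<rbrakk> \<Longrightarrow> pi0r E F p (\<theta> E x y) = \<theta> F (p x) (p y)"
    "\<lbrakk>S \<in> carrier (E0r E); x \<in> carrier E\<rbrakk> \<Longrightarrow> pi0r E F p S (p x) = p (S x)"
    using q_hom q_\<theta> q_act by simp_all
qed

text \<open>The form of uniqueness used for functoriality: a candidate has to be checked on the
  generators only.\<close>

lemma pi0r_eqI:
  assumes "q \<in> star_alg_homs (E0r E) (E0r F)"
    and "\<And>x y. \<lbrakk>x \<in> carrier E; y \<in> carrier E\<rbrakk> \<Longrightarrow> q (\<theta> E x y) = \<theta> F (p x) (p y)"
  shows "pi0r E F p = q"
  by (rule star_alg_homs_E0r_unique[OF pi0r(1) assms(1)]) (simp add: assms(2) pi0r(2))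

lemma canonical_triple_hom: "(p, pi0r E F p) \<in> triple_homs (canonical_triple E) (canonical_triple F)"
proof -
  \<comment> \<open>Forgetting the ternary product changes neither the carriers nor the linear
    operations, hence not the linear maps.\<close>
  have "linear_maps (module.truncate E) (module.truncate F) = linear_maps E F"
    by (rule semilinear_maps_cong) (simp_all add: module.defs)
  moreover have "carrier (module.truncate E) = carrier E"
    by (simp add: module.defs)
  ultimately show ?thesis
    using p pi0r by (simp add: triple_homs_def canonical_triple_def tring_homs_def)
qed

end

section \<open>Functoriality\<close>

lemma category_tring_cat: "category tring_cat"
proof
  fix E F :: "'a tring" and f
  assume "E \<in> objs tring_cat" "F \<in> objs tring_cat" "f \<in> homs tring_cat E F"
  \<comment> \<open>Extensionality is needed for the unit laws: composing with a restricted identity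
    yields a map that is \<open>undefined\<close> outside the carrier.\<close>
  then have "f \<in> carrier E \<rightarrow> carrier F" "f \<in> extensional (carrier E)"
    by (auto simp: tring_cat_def tring_homs_def semilinear_maps_def)
  then show "comp tring_cat E E F f (ident tring_cat E) = f"
    "comp tring_cat E F F (ident tring_cat F) f = f"
    by (simp_all add: tring_cat_def compose_Id Id_compose)
next
  fix E F G H :: "'a tring" and f g h
  assume "f \<in> homs tring_cat E F"
  then have "f \<in> carrier E \<rightarrow> carrier F"
    by (auto simp: tring_cat_def tring_homs_def semilinear_maps_def)
  then show "comp tring_cat E F H (comp tring_cat F G H h g) f
      = comp tring_cat E G H h (comp tring_cat E F G g f)"
    by (simp add: tring_cat_def compose_assoc)
qed (auto simp: tring_cat_def admissible_star_tring_def intro: tring_homs_ident tring_homs_compose)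

lemma triple_homsD:
  assumes "f \<in> triple_homs T U"
  shows "fst f \<in> linear_maps (space T) (space U) \<inter> extensional (carrier (space T))"
    "snd f \<in> star_alg_homs (alg T) (alg U)"
    "\<lbrakk>x \<in> carrier (space T); a \<in> carrier (alg T)\<rbrakk> \<Longrightarrow> fst f (act T x a) = act U (fst f x) (snd f a)"
    "fst f \<in> carrier (space T) \<rightarrow> carrier (space U)"
    "snd f \<in> carrier (alg T) \<rightarrow> carrier (alg U)" "snd f \<in> extensional (carrier (alg T))"
  using assms by (auto simp: triple_homs_def star_alg_homs_def semilinear_maps_def)

lemma category_triple_cat: "category triple_cat"
proof
  fix T :: "('a, 'b) triple"
  assume "T \<in> objs triple_cat"
  then interpret basic_triple T
    by (simp add: triple_cat_def admissible_full_basic_triple_def)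
  show "ident triple_cat T \<in> homs triple_cat T T"
    using linear_maps_ident[OF E.module_axioms] star_alg_homs_ident[OF A.star_algebra_axioms]
      semilinear_mapsD(1)[OF act_linear1]
    by (auto simp: triple_cat_def triple_homs_def)
next
  fix T U V :: "('a, 'b) triple" and f g
  assume "T \<in> objs triple_cat" and fg: "f \<in> homs triple_cat T U" "g \<in> homs triple_cat U V"
  then interpret basic_triple T
    by (simp add: triple_cat_def admissible_full_basic_triple_def)
  have f: "f \<in> triple_homs T U" and g: "g \<in> triple_homs U V"
    using fg by (simp_all add: triple_cat_def)
  show "comp triple_cat T U V g f \<in> homs triple_cat T V"
    using linear_maps_compose[OF E.module_axioms, of "fst f" "space U" "fst g" "space V"]
      star_alg_homs_compose[OF A.star_algebra_axioms triple_homsD(2)[OF f] triple_homsD(2)[OF g]]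
      triple_homsD(1,4,5)[OF f] triple_homsD(1)[OF g] semilinear_mapsD(1)[OF act_linear1]
    by (auto simp: triple_cat_def triple_homs_def compose_eq Pi_iff
        triple_homsD(3)[OF f] triple_homsD(3)[OF g])
next
  fix T U :: "('a, 'b) triple" and f
  assume "f \<in> homs triple_cat T U"
  then have "f \<in> triple_homs T U" by (simp add: triple_cat_def)
  note f = triple_homsD[OF this]
  show "comp triple_cat T T U f (ident triple_cat T) = f"
    "comp triple_cat T U U (ident triple_cat U) f = f"
    using f by (simp_all add: triple_cat_def compose_Id Id_compose prod_eq_iff)
next
  fix S T U V :: "('a, 'b) triple" and f g h
  assume "f \<in> homs triple_cat S T"
  then have "f \<in> triple_homs S T" by (simp add: triple_cat_def)
  note f = triple_homsD(4,5)[OF this]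
  show "comp triple_cat S T V (comp triple_cat T U V h g) f
      = comp triple_cat S U V h (comp triple_cat S T U g f)"
    using f by (simp add: triple_cat_def compose_assoc)
qed

theorem corollary2p11:
  shows "category_functor (tring_cat :: ('a tring, 'a \<Rightarrow> 'a) cat)
           (triple_cat :: (('a, 'a \<Rightarrow> 'a) triple, ('a \<Rightarrow> 'a) \<times> (('a \<Rightarrow> 'a) \<Rightarrow> ('a \<Rightarrow> 'a))) cat)
           canonical_triple
           (\<lambda>E F p. (p, pi0r E F p))"
proof (intro category_functor.intro category_tring_cat category_triple_cat category_functor_axioms.intro)
  interpret C: category "tring_cat :: ('a tring, 'a \<Rightarrow> 'a) cat" by (rule category_tring_cat)
  have hom: "canonical_hom E F p"
    if "E \<in> objs tring_cat" "F \<in> objs tring_cat" "p \<in> homs tring_cat E F"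
    for E F :: "'a tring" and p
    using that
    by (auto simp: tring_cat_def canonical_hom_def canonical_def canonical_hom_axioms_def)
  fix E :: "'a tring"
  assume E: "E \<in> objs tring_cat"
  then interpret E: canonical E by (simp add: tring_cat_def canonical_def)
  show "canonical_triple E \<in> objs triple_cat"
    using E.admissible_full_canonical_triple by (simp add: triple_cat_def)
  \<comment> \<open>The identity of \<open>E0r E\<close> fixes each generator, as the image of the
    identity of \<open>E\<close> must.\<close>
  have "pi0r E E (ident tring_cat E) = (\<lambda>T\<in>carrier (E0r E). T)"
    using E.\<theta>_in_E0r
    by (intro canonical_hom.pi0r_eqI hom E C.ident_in star_alg_homs_ident E.star_algebra_E0r)
      (simp add: tring_cat_def)
  then show "(ident tring_cat E, pi0r E E (ident tring_cat E)) = ident triple_cat (canonical_triple E)"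
    by (simp add: tring_cat_def triple_cat_def canonical_triple_def module.defs)
  fix F :: "'a tring" and p
  assume F: "F \<in> objs tring_cat" and p: "p \<in> homs tring_cat E F"
  interpret p: canonical_hom E F p by (rule hom[OF E F p])
  show "(p, pi0r E F p) \<in> homs triple_cat (canonical_triple E) (canonical_triple F)"
    using p.canonical_triple_hom by (simp add: triple_cat_def)
  fix G :: "'a tring" and r
  assume G: "G \<in> objs tring_cat" and r: "r \<in> homs tring_cat F G"
  interpret r: canonical_hom F G r by (rule hom[OF F G r])
  \<comment> \<open>The composite of the induced maps sends \<theta>(x, y) to \<theta>(r (p x), r (p
    y)), the value that characterises the map induced by the composite.\<close>
  have "pi0r E G (comp tring_cat E F G r p) = compose (carrier (E0r E)) (pi0r F G r) (pi0r E F p)"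
    by (intro canonical_hom.pi0r_eqI hom E G C.comp_in[OF E F G p r]
        star_alg_homs_compose[OF E.star_algebra_E0r p.pi0r(1) r.pi0r(1)])
      (simp add: tring_cat_def compose_eq E.\<theta>_in_E0r p.pi0r(2) r.pi0r(2) p.p_map)
  then show "(comp tring_cat E F G r p, pi0r E G (comp tring_cat E F G r p))
      = comp triple_cat (canonical_triple E) (canonical_triple F) (canonical_triple G)
          (r, pi0r F G r) (p, pi0r E F p)"
    by (simp add: tring_cat_def triple_cat_def canonical_triple_def module.defs)
qed

end
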